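(* Assume the decay of correlations assumption (DC) stated in the context. Let $d\ge1$, let $g_j:\mathcal Y_j\to\mathbb R^d$, $j\ge0$, be measurable functions, let $r:\mathcal E\to[0,\infty)$ be measurable with $\int r\,d\mu=1$, and let $d\nu=r\,d\mu$. For $t\ge0$ and $n\ge1$ set $\mathcal S_n(t)=\sum_{j=0}^{[nt]-1}g_j\circ\overline X_j$, and let $\mathcal S_{n,\mu}(\cdot)$ and $\mathcal S_{n,\nu}(\cdot)$ be the resulting continuous time processes when $x\in\mathcal E$ is distributed according to $\mu$ and $\nu$, respectively. Suppose that for some two conjugate exponents $p$ and $q$ (i.e. $\frac1p+\frac1q=1$), $r$ lies in the $L^p(\mu)$-closure of $B\cap L^p(\mu)$ and $g_j\circ\overline X_j\in L^q(\mu)$ for all $j\ge0$. Let $(b_n)$ be a sequence of positive numbers with $\lim_{n\to\infty}b_n=\infty$. If the sequence of processes $\mathcal S_{n,\mu}(\cdot)/b_n$ converges in distribution in the Skorokhod space $D([0,\infty),\mathbb R^d)$ as $n\to\infty$, then the processes $\mathcal S_{n,\nu}(\cdot)/b_n$ converge in distribution in $D([0,\infty),\mathbb R^d)$ to the same limit. If, moreover, $r$ is positive $\mu$-almost surely, then conversely convergence in distribution of $\mathcal S_{n,\nu}(\cdot)/b_n$ in $D([0,\infty),\mathbb R^d)$ implies convergence in distribution of $\mathcal S_{n,\mu}(\cdot)/b_n$ to the same limit.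
   Context: $(\mathcal E,\mathcal F,\mu)$ is a probability space, $\mathcal X_0,\mathcal X_1,\dots$ are measurable spaces, and $X_j:\mathcal E\to\mathcal X_j$, $j\ge0$, are measurable maps. Set $\mathcal Y_n=\mathcal X_n\times\mathcal X_{n+1}\times\cdots$ and $\overline X_n(x)=(X_n(x),X_{n+1}(x),X_{n+2}(x),\dots)\in\mathcal Y_n$. $[a]$ denotes the integer part of $a$, and empty sums are $0$. Assumption (DC): there is a sequence $(\delta_n)$ converging to $0$ and a set $B$ of real-valued $\mu$-integrable functions on $\mathcal E$ equipped with a "norm" $\|\cdot\|$ (a function $B\to[0,\infty)$) such that for all $n$, all $s\in B$ and all bounded measurable complex-valued functions $f=f(x_n,x_{n+1},\dots)$ on $\mathcal Y_n$, $$\left|\int s\cdot (f\circ\overline X_n)\,d\mu-\int s\,d\mu\cdot\int f\circ\overline X_n\,d\mu\right|\le \|s\|\,\|f\circ\overline X_n\|_{\infty}\,\delta_n,$$ where $\|f\circ\overline X_n\|_\infty$ is the essential supremum with respect to $\mu$. *)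

theory Defs
  imports "HOL-Probability.Probability"
begin

section \<open>The Skorokhod space \<open>D([0,\<infinity>), E)\<close>\<close>

text \<open>
  A path is a function on the whole real line that vanishes on the negative half-line; this makes
  the representation of a function on \<open>[0,\<infinity>)\<close> unique.
\<close>

typedef (overloaded) 'a cadlag =
  "{w :: real \<Rightarrow> 'a :: real_normed_vector.
      (\<forall>t<0. w t = 0) \<and>
      (\<forall>t\<ge>0. continuous (at_right t) w) \<and>
      (\<forall>t>0. \<exists>l. (w \<longlongrightarrow> l) (at_left t))}"
  morphisms path_at Abs_cadlag
  by (rule exI[of _ "\<lambda>_. 0"]) auto

setup_lifting type_definition_cadlag

lemma path_neg: "t < 0 \<Longrightarrow> path_at w t = 0"
  using path_at[of w] by auto

lemma path_right_continuous: "0 \<le> t \<Longrightarrow> (path_at w \<longlongrightarrow> path_at w t) (at_right t)"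
  using path_at[of w] by (auto simp: continuous_within)

text \<open>Increasing bijections of \<open>[0,\<infinity>)\<close>; these are automatically continuous and fix \<open>0\<close>.\<close>

definition time_changes :: "(real \<Rightarrow> real) set" where
  "time_changes = {l. bij_betw l {0..} {0..} \<and> strict_mono_on {0..} l}"

definition taper :: "nat \<Rightarrow> real \<Rightarrow> real" where
  "taper N t = max 0 (min 1 (real N + 1 - t))"

text \<open>
  The metric is the standard one for the J1 topology on \<open>D([0,\<infinity>), E)\<close>: with
  \<open>x\<^sub>N = taper N \<cdot> x\<close>, the quantity \<open>skorokhod_dist_upto N x y\<close> is the minimum of \<open>1\<close> and the
  infimum over all time changes \<open>l\<close> of
  \<open>max (sup\<^sub>t \<bar>l t - t\<bar>) (sup\<^sub>t \<parallel>x\<^sub>N (l t) - y\<^sub>N t\<parallel>)\<close>, and these are summed with weights \<open>2\<^sup>-\<^sup>N\<^sup>-\<^sup>1\<close>.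
  Convergence \<open>x\<^sub>k \<longlonglongrightarrow> x\<close> in this metric means that there are time changes \<open>l\<^sub>k\<close> such that
  \<open>l\<^sub>k t - t \<longlonglongrightarrow> 0\<close> uniformly and \<open>x\<^sub>k (l\<^sub>k t) - x t \<longlonglongrightarrow> 0\<close> uniformly on bounded sets of times.
\<close>

definition skorokhod_within :: "nat \<Rightarrow> 'a::real_normed_vector cadlag \<Rightarrow> 'a cadlag \<Rightarrow> real \<Rightarrow> bool" where
  "skorokhod_within N x y e \<longleftrightarrow>
     (\<exists>l\<in>time_changes. \<forall>t\<ge>0. \<bar>l t - t\<bar> \<le> e \<and>
        norm (taper N (l t) *\<^sub>R path_at x (l t) - taper N t *\<^sub>R path_at y t) \<le> e)"

definition skorokhod_dist_upto :: "nat \<Rightarrow> 'a::real_normed_vector cadlag \<Rightarrow> 'a cadlag \<Rightarrow> real" where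
  "skorokhod_dist_upto N x y = Inf (insert 1 {e. skorokhod_within N x y e})"

lemma time_changes_nonneg: "l \<in> time_changes \<Longrightarrow> 0 \<le> t \<Longrightarrow> 0 \<le> l t"
  by (auto simp: time_changes_def bij_betw_def)

lemma id_in_time_changes: "(\<lambda>t. t) \<in> time_changes"
  by (auto simp: time_changes_def bij_betw_def strict_mono_on_def)

lemma time_changes_comp:
  assumes "l \<in> time_changes" "m \<in> time_changes"
  shows "(\<lambda>t. l (m t)) \<in> time_changes"
proof -
  have "bij_betw (l \<circ> m) {0..} {0..}"
    using assms by (auto simp: time_changes_def intro: bij_betw_trans)
  moreover have "strict_mono_on {0..} (l \<circ> m)"
    using assms time_changes_nonneg[OF assms(2)]
    by (auto simp: time_changes_def strict_mono_on_def)
  ultimately show ?thesis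
    by (simp add: time_changes_def comp_def)
qed

lemma time_changes_inverse:
  assumes l: "l \<in> time_changes"
  obtains m where "m \<in> time_changes" "\<And>t. 0 \<le> t \<Longrightarrow> l (m t) = t"
proof
  let ?m = "the_inv_into {0..} l"
  have b: "bij_betw l {0..} {0..}" and s: "strict_mono_on {0..} l"
    using l by (auto simp: time_changes_def)
  have bm: "bij_betw ?m {0..} {0..}"
    by (rule bij_betw_the_inv_into[OF b])
  show inv: "l (?m t) = t" if "0 \<le> t" for t
    using b that by (auto simp: bij_betw_def intro: f_the_inv_into_f)
  have nn: "0 \<le> ?m t" if "0 \<le> t" for t
    using bm that by (auto simp: bij_betw_def)
  have "?m a < ?m b" if "0 \<le> a" "a < b" for a b
  proof (rule ccontr)
    assume "\<not> ?m a < ?m b"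
    then have "l (?m b) \<le> l (?m a)"
      using nn[of a] nn[of b] that s
      by (cases "?m a = ?m b") (auto simp: strict_mono_on_def intro!: less_imp_le)
    with that inv[of a] inv[of b] show False by simp
  qed
  with bm show "?m \<in> time_changes"
    by (auto simp: time_changes_def strict_mono_on_def)
qed

lemma skorokhod_within_nonneg: "skorokhod_within N x y e \<Longrightarrow> 0 \<le> e"
  unfolding skorokhod_within_def by (force dest: spec[of _ 0])

lemma skorokhod_within_refl: "skorokhod_within N x x 0"
  unfolding skorokhod_within_def by (rule bexI[OF _ id_in_time_changes]) auto

lemma skorokhod_within_sym:
  assumes "skorokhod_within N x y e"
  shows "skorokhod_within N y x e"
proof -
  obtain l where l: "l \<in> time_changes" and le: "\<And>t. 0 \<le> t \<Longrightarrow> \<bar>l t - t\<bar> \<le> e \<and>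
        norm (taper N (l t) *\<^sub>R path_at x (l t) - taper N t *\<^sub>R path_at y t) \<le> e"
    using assms by (auto simp: skorokhod_within_def)
  obtain m where m: "m \<in> time_changes" "\<And>t. 0 \<le> t \<Longrightarrow> l (m t) = t"
    by (rule time_changes_inverse[OF l]) blast
  show ?thesis
    unfolding skorokhod_within_def
  proof (intro bexI[OF _ m(1)] allI impI)
    fix t :: real assume t: "0 \<le> t"
    show "\<bar>m t - t\<bar> \<le> e \<and>
        norm (taper N (m t) *\<^sub>R path_at y (m t) - taper N t *\<^sub>R path_at x t) \<le> e"
      using le[OF time_changes_nonneg[OF m(1) t]] m(2)[OF t]
      by (simp add: abs_minus_commute norm_minus_commute)
  qed
qed

lemma skorokhod_within_trans:
  assumes "skorokhod_within N x y d" "skorokhod_within N y z e"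
  shows "skorokhod_within N x z (d + e)"
proof -
  obtain l where l: "l \<in> time_changes" and ld: "\<And>t. 0 \<le> t \<Longrightarrow> \<bar>l t - t\<bar> \<le> d \<and>
        norm (taper N (l t) *\<^sub>R path_at x (l t) - taper N t *\<^sub>R path_at y t) \<le> d"
    using assms by (auto simp: skorokhod_within_def)
  obtain m where m: "m \<in> time_changes" and me: "\<And>t. 0 \<le> t \<Longrightarrow> \<bar>m t - t\<bar> \<le> e \<and>
        norm (taper N (m t) *\<^sub>R path_at y (m t) - taper N t *\<^sub>R path_at z t) \<le> e"
    using assms by (auto simp: skorokhod_within_def)
  show ?thesis
    unfolding skorokhod_within_def
  proof (intro bexI[OF _ time_changes_comp[OF l m]] allI impI)
    fix t :: real assume t: "0 \<le> t"
    note 1 = ld[OF time_changes_nonneg[OF m t]] and 2 = me[OF t]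
    have "norm (taper N (l (m t)) *\<^sub>R path_at x (l (m t)) - taper N t *\<^sub>R path_at z t) \<le> d + e"
      using 1 2 by (intro norm_diff_triangle_le) auto
    then show "\<bar>l (m t) - t\<bar> \<le> d + e \<and>
        norm (taper N (l (m t)) *\<^sub>R path_at x (l (m t)) - taper N t *\<^sub>R path_at z t) \<le> d + e"
      using 1 2 by linarith
  qed
qed

lemma skorokhod_bdd_below: "bdd_below (insert 1 {e. skorokhod_within N x y e})"
  by (rule bdd_belowI[of _ 0]) (auto dest: skorokhod_within_nonneg)

lemma skorokhod_dist_upto_le_1: "skorokhod_dist_upto N x y \<le> 1"
  unfolding skorokhod_dist_upto_def by (rule cInf_lower[OF _ skorokhod_bdd_below]) simp

lemma skorokhod_dist_upto_le: "skorokhod_within N x y e \<Longrightarrow> skorokhod_dist_upto N x y \<le> e"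
  unfolding skorokhod_dist_upto_def by (rule cInf_lower[OF _ skorokhod_bdd_below]) simp

lemma skorokhod_dist_upto_greatest:
  "c \<le> 1 \<Longrightarrow> (\<And>e. skorokhod_within N x y e \<Longrightarrow> c \<le> e) \<Longrightarrow> c \<le> skorokhod_dist_upto N x y"
  unfolding skorokhod_dist_upto_def by (rule cInf_greatest) auto

lemma skorokhod_dist_upto_nonneg: "0 \<le> skorokhod_dist_upto N x y"
  by (rule skorokhod_dist_upto_greatest) (auto dest: skorokhod_within_nonneg)

lemma skorokhod_dist_upto_refl: "skorokhod_dist_upto N x x = 0"
  using skorokhod_dist_upto_le[OF skorokhod_within_refl] skorokhod_dist_upto_nonneg
  by (rule antisym)

lemma skorokhod_dist_upto_sym: "skorokhod_dist_upto N x y = skorokhod_dist_upto N y x"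
proof -
  have "skorokhod_within N x y e \<longleftrightarrow> skorokhod_within N y x e" for e
    using skorokhod_within_sym by blast
  then show ?thesis by (simp add: skorokhod_dist_upto_def)
qed

lemma skorokhod_dist_upto_triangle:
  "skorokhod_dist_upto N x z \<le> skorokhod_dist_upto N x y + skorokhod_dist_upto N y z"
proof -
  have *: "skorokhod_dist_upto N x z - d \<le> skorokhod_dist_upto N y z"
    if "skorokhod_within N x y d" for d
    using skorokhod_dist_upto_le_1[of N x z] skorokhod_within_nonneg[OF that]
      skorokhod_dist_upto_le[OF skorokhod_within_trans[OF that]]
    by (intro skorokhod_dist_upto_greatest) (auto simp: algebra_simps)
  have "skorokhod_dist_upto N x z - skorokhod_dist_upto N y z \<le> skorokhod_dist_upto N x y"
    using skorokhod_dist_upto_le_1[of N x z] skorokhod_dist_upto_nonneg[of N y z] *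
    by (intro skorokhod_dist_upto_greatest) (auto simp: algebra_simps)
  then show ?thesis by simp
qed

lemma skorokhod_within_less:
  assumes "skorokhod_dist_upto N x y < e" "e \<le> 1"
  obtains d where "skorokhod_within N x y d" "d < e"
proof -
  have "\<exists>d\<in>insert 1 {e. skorokhod_within N x y e}. d < e"
    using assms cInf_lessD[of "insert 1 {e. skorokhod_within N x y e}" e]
    unfolding skorokhod_dist_upto_def by blast
  with assms(2) that show ?thesis by auto
qed

lemma skorokhod_dist_eq_0:
  assumes 0: "\<And>N. skorokhod_dist_upto N x y = 0"
  shows "x = y"
proof -
  have "path_at x t = path_at y t" if t: "0 \<le> t" for t
  proof -
    have "norm (path_at x t - path_at y t) \<le> 3 * e" if e: "0 < e" "e \<le> 1" for e
    proof -
      have "\<forall>\<^sub>F s in at_right t. dist (path_at x s) (path_at x t) < e \<and> dist (path_at y s) (path_at y t) < e"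
        using path_right_continuous[OF t] e by (auto intro!: eventually_conj tendstoD)
      then obtain b where b: "t < b" and
        near: "\<And>s. t < s \<Longrightarrow> s < b \<Longrightarrow> dist (path_at x s) (path_at x t) < e \<and> dist (path_at y s) (path_at y t) < e"
        unfolding eventually_at_right_field by blast
      define s where "s = (t + min b (t + 1)) / 2"
      have s: "t < s" "s < b" "s < t + 1" "0 \<le> s"
        using b t by (auto simp: s_def min_def)
      define N where "N = nat \<lceil>t + 1\<rceil>"
      have N: "t + 1 \<le> real N" unfolding N_def by linarith
      define \<eta> where "\<eta> = min e (min (s - t) (min (b - s) (t + 1 - s)))"
      have \<eta>: "0 < \<eta>" "\<eta> \<le> e" "\<eta> \<le> s - t" "\<eta> \<le> b - s" "\<eta> \<le> t + 1 - s"
        using s e by (auto simp: \<eta>_def)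
      have "skorokhod_dist_upto N x y < \<eta>" "\<eta> \<le> 1"
        using 0 \<eta> e by auto
      then obtain d where "skorokhod_within N x y d" "d < \<eta>"
        by (rule skorokhod_within_less)
      then obtain l where "\<bar>l s - s\<bar> \<le> d"
        and n: "norm (taper N (l s) *\<^sub>R path_at x (l s) - taper N s *\<^sub>R path_at y s) \<le> d"
        using s by (auto simp: skorokhod_within_def)
      then have l: "t < l s" "l s < b" "l s < t + 1"
        using \<eta> \<open>d < \<eta>\<close> by linarith+
      have "taper N (l s) = 1" "taper N s = 1"
        using N l s by (auto simp: taper_def)
      with n \<open>d < \<eta>\<close> \<eta> have "dist (path_at x (l s)) (path_at y s) \<le> e"
        by (simp add: dist_norm)
      moreover have "dist (path_at x (l s)) (path_at x t) < e" "dist (path_at y s) (path_at y t) < e"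
        using near l s by auto
      ultimately have "dist (path_at x t) (path_at y t) \<le> 3 * e"
        using dist_triangle[of "path_at x t" "path_at y t" "path_at x (l s)"]
          dist_triangle[of "path_at x (l s)" "path_at y t" "path_at y s"]
        by (simp add: dist_commute)
      then show ?thesis by (simp add: dist_norm)
    qed
    note le = this
    have "norm (path_at x t - path_at y t) \<le> 0 + e" if "0 < e" for e
      using le[of "min 1 (e / 3)"] that by (cases "3 \<le> e") auto
    then have "norm (path_at x t - path_at y t) \<le> 0" by (rule field_le_epsilon)
    then show ?thesis by simp
  qed
  then have "path_at x = path_at y"
    by (intro ext) (metis path_neg linorder_not_le)
  then show ?thesis by (simp add: path_at_inject)
qed

instantiation cadlag :: (real_normed_vector) metric_space
begin

definition dist_cadlag :: "'a cadlag \<Rightarrow> 'a cadlag \<Rightarrow> real" where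
  "dist_cadlag x y = (\<Sum>N. (1/2) ^ Suc N * skorokhod_dist_upto N x y)"

definition uniformity_cadlag :: "('a cadlag \<times> 'a cadlag) filter" where
  "uniformity_cadlag = (INF e\<in>{0<..}. principal {(x, y). dist x y < e})"

definition open_cadlag :: "'a cadlag set \<Rightarrow> bool" where
  "open_cadlag U = (\<forall>x\<in>U. \<forall>\<^sub>F (x', y) in uniformity. x' = x \<longrightarrow> y \<in> U)"

lemma summable_dist_cadlag:
  "summable (\<lambda>N. (1/2) ^ Suc N * skorokhod_dist_upto N x (y :: 'a cadlag))"
proof (rule summable_comparison_test')
  show "summable (\<lambda>N. (1/2 :: real) ^ Suc N)"
    using summable_geometric[of "1/2 :: real"] by (subst summable_Suc_iff) auto
  show "norm ((1/2) ^ Suc N * skorokhod_dist_upto N x y) \<le> (1/2) ^ Suc N" for N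
    using skorokhod_dist_upto_le_1[of N x y] skorokhod_dist_upto_nonneg[of N x y]
      mult_left_mono[OF skorokhod_dist_upto_le_1[of N x y], of "(1/2) ^ Suc N"]
    by (simp add: abs_mult)
qed

instance
proof
  fix x y z :: "'a cadlag"
  show "uniformity = (INF e\<in>{0<..}. principal {(x, y :: 'a cadlag). dist x y < e})"
    by (rule uniformity_cadlag_def)
  show "open U = (\<forall>x\<in>U. \<forall>\<^sub>F (x', y) in uniformity. x' = x \<longrightarrow> y \<in> U)" for U :: "'a cadlag set"
    by (rule open_cadlag_def)
  have sym: "dist u v = dist v u" for u v :: "'a cadlag"
    unfolding dist_cadlag_def by (metis skorokhod_dist_upto_sym)
  show "dist x y \<le> dist x z + dist y z"
  proof -
    have "dist x y \<le> (\<Sum>N. (1/2) ^ Suc N * skorokhod_dist_upto N x z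
        + (1/2) ^ Suc N * skorokhod_dist_upto N z y)"
      unfolding dist_cadlag_def
      by (intro suminf_le summable_add summable_dist_cadlag)
        (simp add: skorokhod_dist_upto_triangle flip: distrib_left)
    also have "\<dots> = dist x z + dist z y"
      unfolding dist_cadlag_def by (intro suminf_add[symmetric] summable_dist_cadlag)
    finally show ?thesis by (simp only: sym[of z y])
  qed
  show "dist x y = 0 \<longleftrightarrow> x = y"
  proof
    assume "dist x y = 0"
    then have "\<forall>N. (1/2) ^ Suc N * skorokhod_dist_upto N x y = 0"
      unfolding dist_cadlag_def
      by (subst (asm) suminf_eq_zero_iff[OF summable_dist_cadlag])
        (auto simp: skorokhod_dist_upto_nonneg)
    then show "x = y" by (intro skorokhod_dist_eq_0) simp
  next
    show "x = y \<Longrightarrow> dist x y = 0"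
      by (simp add: dist_cadlag_def skorokhod_dist_upto_refl)
  qed
qed

end

section \<open>Convergence in distribution\<close>

definition weakly_converges :: "(nat \<Rightarrow> 'a::topological_space measure) \<Rightarrow> 'a measure \<Rightarrow> bool" where
  "weakly_converges P Q \<longleftrightarrow>
     (\<forall>F :: 'a \<Rightarrow> real. continuous_on UNIV F \<and> bounded (range F) \<longrightarrow>
        (\<lambda>n. LINT w|P n. F w) \<longlonglongrightarrow> (LINT w|Q. F w))"

text \<open>The limit is recorded through its law \<open>Q\<close>, a Borel probability measure.\<close>

definition converges_in_distribution ::
  "'e measure \<Rightarrow> (nat \<Rightarrow> 'e \<Rightarrow> 'a::topological_space) \<Rightarrow> 'a measure \<Rightarrow> bool" where
  "converges_in_distribution M Z Q \<longleftrightarrow>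
     prob_space Q \<and> sets Q = sets borel \<and> (\<forall>n. Z n \<in> borel_measurable M) \<and>
     weakly_converges (\<lambda>n. distr M borel (Z n)) Q"

section \<open>\<open>L\<^sup>p\<close> spaces, \<open>1 \<le> p \<le> \<infinity>\<close>\<close>

definition Lp_norm :: "ennreal \<Rightarrow> 'e measure \<Rightarrow> ('e \<Rightarrow> 'a::real_normed_vector) \<Rightarrow> real" where
  "Lp_norm p M f =
     (if p = \<infinity> then real_of_ereal (esssup M (\<lambda>x. ereal (norm (f x))))
      else (LINT x|M. norm (f x) powr enn2real p) powr (1 / enn2real p))"

definition Lp :: "ennreal \<Rightarrow> 'e measure \<Rightarrow> ('e \<Rightarrow> 'a::real_normed_vector) set" where
  "Lp p M =
     {f \<in> borel_measurable M.
        if p = \<infinity> then esssup M (\<lambda>x. ereal (norm (f x))) < \<infinity>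
        else integrable M (\<lambda>x. norm (f x) powr enn2real p)}"

definition Lp_closure ::
  "ennreal \<Rightarrow> 'e measure \<Rightarrow> ('e \<Rightarrow> 'a::real_normed_vector) set \<Rightarrow> ('e \<Rightarrow> 'a) set" where
  "Lp_closure p M A = {f \<in> Lp p M. \<forall>\<epsilon>>0. \<exists>s\<in>A. Lp_norm p M (\<lambda>x. f x - s x) < \<epsilon>}"

section \<open>Decay of correlations\<close>

text \<open>
  The spaces \<open>\<X>\<^sub>j\<close> are measures \<open>N j\<close> on a common type, of which only the \<open>\<sigma>\<close>-algebra matters.
  An element \<open>(x\<^sub>n, x\<^sub>n\<^sub>+\<^sub>1, \<dots>)\<close> of \<open>\<Y>\<^sub>n\<close> is the function \<open>\<lambda>k. x\<^sub>n\<^sub>+\<^sub>k\<close>.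
\<close>

definition tail_space :: "(nat \<Rightarrow> 'x measure) \<Rightarrow> nat \<Rightarrow> (nat \<Rightarrow> 'x) measure" where
  "tail_space N n = (\<Pi>\<^sub>M k\<in>UNIV. N (n + k))"

definition tail_map :: "(nat \<Rightarrow> 'e \<Rightarrow> 'x) \<Rightarrow> nat \<Rightarrow> 'e \<Rightarrow> nat \<Rightarrow> 'x" where
  "tail_map X n x = (\<lambda>k. X (n + k) x)"

definition decay_of_correlations ::
  "'e measure \<Rightarrow> (nat \<Rightarrow> 'x measure) \<Rightarrow> (nat \<Rightarrow> 'e \<Rightarrow> 'x) \<Rightarrow>
   ('e \<Rightarrow> real) set \<Rightarrow> (('e \<Rightarrow> real) \<Rightarrow> real) \<Rightarrow> (nat \<Rightarrow> real) \<Rightarrow> bool" where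
  "decay_of_correlations M N X B nrm \<delta> \<longleftrightarrow>
     \<delta> \<longlonglongrightarrow> 0 \<and>
     (\<forall>s\<in>B. integrable M s \<and> 0 \<le> nrm s) \<and>
     (\<forall>n. \<forall>s\<in>B. \<forall>f :: (nat \<Rightarrow> 'x) \<Rightarrow> complex.
        f \<in> borel_measurable (tail_space N n) \<and> bounded (f ` space (tail_space N n)) \<longrightarrow>
        cmod ((LINT x|M. of_real (s x) * f (tail_map X n x))
              - of_real (LINT x|M. s x) * (LINT x|M. f (tail_map X n x)))
        \<le> nrm s * Lp_norm \<infinity> M (\<lambda>x. f (tail_map X n x)) * \<delta> n)"

section \<open>The partial sum processes\<close>

lemma eventually_floor_at_right:
  "\<forall>\<^sub>F s in at_right t. \<lfloor>real n * s\<rfloor> = \<lfloor>real n * t\<rfloor>"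
proof -
  let ?d = "(of_int \<lfloor>real n * t\<rfloor> + 1 - real n * t) / (real n + 1)"
  have pos: "0 < ?d" by (intro divide_pos_pos) linarith+
  have "\<lfloor>real n * s\<rfloor> = \<lfloor>real n * t\<rfloor>" if "t < s" "s < t + ?d" for s
  proof -
    have "real n * t \<le> real n * s" using that by (simp add: mult_left_mono)
    moreover have "(real n + 1) * (s - t) < of_int \<lfloor>real n * t\<rfloor> + 1 - real n * t"
      using that by (simp add: field_simps)
    ultimately show ?thesis using that(1) by (intro floor_unique) (auto simp: algebra_simps, linarith+)
  qed
  then show ?thesis
    unfolding eventually_at_right_field using pos by (intro exI[of _ "t + ?d"]) simp
qed

lemma eventually_floor_at_left:
  "\<exists>k. \<forall>\<^sub>F s in at_left t. \<lfloor>real n * s\<rfloor> = k"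
proof (cases "n = 0")
  case False
  let ?k = "\<lceil>real n * t\<rceil> - 1"
  have n: "0 < real n" using False by simp
  have "\<lfloor>real n * s\<rfloor> = ?k" if "of_int ?k / real n < s" "s < t" for s
  proof (rule floor_unique)
    show "of_int ?k \<le> real n * s" using that(1) n by (simp add: field_simps)
    have "real n * s < real n * t" using that n by simp
    also have "\<dots> \<le> of_int ?k + 1" by simp
    finally show "real n * s < of_int ?k + 1" by simp
  qed
  moreover have "of_int ?k / real n < t"
    using n by (simp add: divide_less_eq mult.commute) linarith
  ultimately show ?thesis
    unfolding eventually_at_left_field by (intro exI[of _ ?k] exI[of _ "of_int ?k / real n"]) simp
qed simp

text \<open>The integer truncation \<open>nat\<close> turns negative times into empty sums.\<close>

lift_definition sum_path :: "nat \<Rightarrow> (nat \<Rightarrow> 'a) \<Rightarrow> 'a::real_normed_vector cadlag" is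
  "\<lambda>n a t. \<Sum>j<nat \<lfloor>real n * t\<rfloor>. a j"
proof (intro conjI allI impI)
  fix n :: nat and a :: "nat \<Rightarrow> 'a" and t :: real
  show "(\<Sum>j<nat \<lfloor>real n * t\<rfloor>. a j) = 0" if "t < 0"
  proof -
    have "real n * t \<le> 0" using that by (intro mult_nonneg_nonpos) auto
    then have "nat \<lfloor>real n * t\<rfloor> = 0" by linarith
    then show ?thesis by simp
  qed
  show "continuous (at_right t) (\<lambda>t. \<Sum>j<nat \<lfloor>real n * t\<rfloor>. a j)"
    unfolding continuous_within
    by (rule tendsto_eventually) (rule eventually_mono[OF eventually_floor_at_right[where n = n and t = t]], simp)
  obtain k where k: "\<forall>\<^sub>F s in at_left t. \<lfloor>real n * s\<rfloor> = k"
    using eventually_floor_at_left by blast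
  show "\<exists>l. ((\<lambda>t. \<Sum>j<nat \<lfloor>real n * t\<rfloor>. a j) \<longlongrightarrow> l) (at_left t)"
    by (rule exI[of _ "\<Sum>j<nat k. a j"], rule tendsto_eventually) (rule eventually_mono[OF k], simp)
qed

lift_definition scale_path :: "real \<Rightarrow> 'a cadlag \<Rightarrow> 'a::real_normed_vector cadlag" is
  "\<lambda>c w t. c *\<^sub>R w t"
proof (intro conjI allI impI; elim conjE)
  fix c t :: real and w :: "real \<Rightarrow> 'a"
  show "c *\<^sub>R w t = 0" if "t < 0" "\<forall>t<0. w t = 0" using that by simp
  show "continuous (at_right t) (\<lambda>t. c *\<^sub>R w t)"
    if "0 \<le> t" "\<forall>t\<ge>0. continuous (at_right t) w"
    using that by (intro continuous_scaleR continuous_const) simp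
  show "\<exists>l. ((\<lambda>t. c *\<^sub>R w t) \<longlongrightarrow> l) (at_left t)"
    if "0 < t" "\<forall>t>0. \<exists>l. (w \<longlongrightarrow> l) (at_left t)"
  proof -
    from that obtain l where "(w \<longlongrightarrow> l) (at_left t)" by blast
    from tendsto_scaleR[OF tendsto_const this] show ?thesis by (rule exI)
  qed
qed

definition partial_sum_process ::
  "(nat \<Rightarrow> 'e \<Rightarrow> 'x) \<Rightarrow> (nat \<Rightarrow> (nat \<Rightarrow> 'x) \<Rightarrow> 'a::real_normed_vector) \<Rightarrow> nat \<Rightarrow> 'e \<Rightarrow> 'a cadlag" where
  "partial_sum_process X g n x = sum_path n (\<lambda>j. g j (tail_map X j x))"

lemma continuous_scale_sum_path:
  "continuous_on UNIV (\<lambda>a :: nat \<Rightarrow> 'a::real_normed_vector. scale_path c (sum_path n a))"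
  unfolding continuous_on_eq_continuous_within continuous_within
proof
  let ?T = "\<lambda>a. scale_path c (sum_path n a) :: 'a cadlag"
  fix a\<^sub>0 :: "nat \<Rightarrow> 'a"
  have upto: "((\<lambda>a. (1/2) ^ Suc N * skorokhod_dist_upto N (?T a) (?T a\<^sub>0)) \<longlongrightarrow> 0) (at a\<^sub>0)" for N
  proof -
    let ?e = "\<lambda>a. \<bar>c\<bar> * (\<Sum>j<nat \<lfloor>real n * (real N + 1)\<rfloor>. norm (a j - a\<^sub>0 j))"
    have "skorokhod_dist_upto N (?T a) (?T a\<^sub>0) \<le> ?e a" for a
    proof (intro skorokhod_dist_upto_le, unfold skorokhod_within_def,
        intro bexI[OF _ id_in_time_changes] allI impI conjI)
      fix t :: real assume t: "0 \<le> t"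
      show "\<bar>t - t\<bar> \<le> ?e a" by (simp add: sum_nonneg)
      show "norm (taper N t *\<^sub>R path_at (?T a) t - taper N t *\<^sub>R path_at (?T a\<^sub>0) t) \<le> ?e a"
      proof (cases "t \<le> real N + 1")
        case True
        have "norm (taper N t *\<^sub>R path_at (?T a) t - taper N t *\<^sub>R path_at (?T a\<^sub>0) t)
            = \<bar>taper N t\<bar> * norm (path_at (?T a) t - path_at (?T a\<^sub>0) t)"
          by (simp flip: scaleR_diff_right)
        also have "\<dots> \<le> 1 * norm (path_at (?T a) t - path_at (?T a\<^sub>0) t)"
          by (intro mult_right_mono) (auto simp: taper_def)
        also have "\<dots> = \<bar>c\<bar> * norm (\<Sum>j<nat \<lfloor>real n * t\<rfloor>. a j - a\<^sub>0 j)"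
          by (simp add: scale_path.rep_eq sum_path.rep_eq sum_subtractf flip: scaleR_diff_right)
        also have "norm (\<Sum>j<nat \<lfloor>real n * t\<rfloor>. a j - a\<^sub>0 j) \<le> (\<Sum>j<nat \<lfloor>real n * t\<rfloor>. norm (a j - a\<^sub>0 j))"
          by (rule norm_sum)
        also have "\<dots> \<le> (\<Sum>j<nat \<lfloor>real n * (real N + 1)\<rfloor>. norm (a j - a\<^sub>0 j))"
          using True by (intro sum_mono2) (auto intro!: nat_mono floor_mono mult_left_mono elim!: less_le_trans)
        finally show ?thesis by (simp add: mult_left_mono)
      qed (simp add: taper_def sum_nonneg)
    qed
    moreover have "(?e \<longlongrightarrow> \<bar>c\<bar> * (\<Sum>j<nat \<lfloor>real n * (real N + 1)\<rfloor>. norm (a\<^sub>0 j - a\<^sub>0 j))) (at a\<^sub>0)"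
    proof -
      have "((\<lambda>a. a j) \<longlongrightarrow> a\<^sub>0 j) (at a\<^sub>0)" for j
        using continuous_on_product_coordinates[of j] unfolding continuous_on_def by blast
      then show ?thesis
        by (intro tendsto_mult tendsto_const tendsto_sum tendsto_norm tendsto_diff)
    qed
    ultimately have le: "\<And>a. skorokhod_dist_upto N (?T a) (?T a\<^sub>0) \<le> ?e a"
      and lim: "(?e \<longlongrightarrow> 0) (at a\<^sub>0)"
      by simp_all
    have "((\<lambda>a. skorokhod_dist_upto N (?T a) (?T a\<^sub>0)) \<longlongrightarrow> 0) (at a\<^sub>0)"
      by (rule tendsto_sandwich[OF always_eventually always_eventually tendsto_const lim])
        (use skorokhod_dist_upto_nonneg le in blast)+
    then show ?thesis by (rule tendsto_mult_right_zero)
  qed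
  show "(?T \<longlongrightarrow> ?T a\<^sub>0) (at a\<^sub>0)"
  proof (cases "at a\<^sub>0 = bot")
    case False
    have "((\<lambda>a. \<Sum>N. (1/2) ^ Suc N * skorokhod_dist_upto N (?T a) (?T a\<^sub>0)) \<longlongrightarrow> (\<Sum>N::nat. 0)) (at a\<^sub>0)"
    proof (rule tannerys_theorem[THEN conjunct2, THEN conjunct2, OF upto _ _ False])
      show "summable (\<lambda>N. (1/2 :: real) ^ Suc N)"
        using summable_geometric[of "1/2 :: real"] by (subst summable_Suc_iff) auto
      have "norm ((1/2) ^ Suc N * skorokhod_dist_upto N (?T a) (?T a\<^sub>0)) \<le> (1/2) ^ Suc N" for N a
        using skorokhod_dist_upto_nonneg[of N "?T a" "?T a\<^sub>0"]
          mult_left_mono[OF skorokhod_dist_upto_le_1[of N "?T a" "?T a\<^sub>0"], of "(1/2) ^ Suc N"]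
        by (simp add: abs_mult)
      then show "\<forall>\<^sub>F (N, a) in sequentially \<times>\<^sub>F at a\<^sub>0.
          norm ((1/2) ^ Suc N * skorokhod_dist_upto N (?T a) (?T a\<^sub>0)) \<le> (1/2) ^ Suc N"
        by (intro always_eventually) auto
    qed
    then show ?thesis
      by (subst tendsto_dist_iff) (simp add: dist_cadlag_def)
  qed simp
qed

text \<open>
  Hence the measurability clause of \<open>converges_in_distribution\<close> always holds for these processes.
\<close>

lemma partial_sum_process_measurable:
  fixes g :: "nat \<Rightarrow> (nat \<Rightarrow> 'x) \<Rightarrow> 'a::{real_normed_vector, second_countable_topology}"
  assumes X: "\<And>j. X j \<in> measurable M (N j)"
    and g: "\<And>j. g j \<in> borel_measurable (tail_space N j)"
  shows "(\<lambda>x. scale_path c (partial_sum_process X g n x)) \<in> borel_measurable M"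
proof -
  have tm: "tail_map X j \<in> measurable M (tail_space N j)" for j
    unfolding tail_map_def tail_space_def by (intro measurable_PiM_single') (auto intro: X simp: measurable_space[OF X])
  have "(\<lambda>x j. g j (tail_map X j x)) \<in> measurable M (\<Pi>\<^sub>M j\<in>UNIV. borel)"
    by (intro measurable_PiM_single') (auto intro: measurable_compose[OF tm g])
  then have "(\<lambda>x j. g j (tail_map X j x)) \<in> borel_measurable M"
    using measurable_cong_sets[OF refl sets_PiM_equal_borel] by blast
  from measurable_compose[OF this borel_measurable_continuous_onI[OF continuous_scale_sum_path]]
  show ?thesis by (simp add: partial_sum_process_def)
qed

end

theory Submission
  imports Defs
begin

text \<open>
  Bounded Lipschitz functions \<open>F\<close> determine weak convergence, so both implications follow once
  \<open>\<integral> r \<cdot> F(Z\<^sub>n) d\<mu> - \<integral> F(Z\<^sub>n) d\<mu> \<longlonglongrightarrow> 0\<close> for the normalised processes \<open>Z\<^sub>n\<close>. Approximate \<open>r\<close> in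
  \<open>L\<^sup>1\<close> by some \<open>s \<in> B\<close> and choose \<open>k\<close> with \<open>\<delta>\<^sub>k\<close> small compared to \<open>\<parallel>s\<parallel>\<close>. Deleting the first
  \<open>k\<close> summands moves \<open>Z\<^sub>n\<close> by a Skorokhod distance of order \<open>1 / b\<^sub>n\<close>, which is negligible by dominated
  convergence, and leaves a function of \<open>(X\<^sub>k, X\<^sub>k\<^sub>+\<^sub>1, \<dots>)\<close>, to which the decay of correlations
  applies at the fixed time \<open>k\<close>.
\<close>

section \<open>Weak convergence through Lipschitz test functions\<close>

text \<open>As a function of \<open>x\<close>, each \<open>F y + k * dist x y\<close> is
  \<open>k\<close>-Lipschitz, and the infimum over \<open>y\<close> inherits this. The lower bound
  \<open>- C\<close> of \<open>F\<close> keeps the infimum finite, and the choice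
  \<open>y = x\<close> keeps it below \<open>F\<close>.\<close>

lemma inf_convolution_lipschitz:
  fixes F :: "'a::metric_space \<Rightarrow> real"
  assumes C: "\<And>x. \<bar>F x\<bar> \<le> C" and k: "0 \<le> k"
  defines "G \<equiv> \<lambda>x. INF y. F y + k * dist x y"
  shows "k-lipschitz_on UNIV G" and "\<bar>G x\<bar> \<le> C" and "G x \<le> F x"
proof -
  have bdd: "bdd_below (range (\<lambda>y. F y + k * dist x y))" for x
  proof (rule bdd_belowI2)
    fix y show "- C \<le> F y + k * dist x y"
      using C[of y] k mult_nonneg_nonneg[OF k zero_le_dist[of x y]] by linarith
  qed
  have le: "G x \<le> F y + k * dist x y" for x y
    unfolding G_def by (rule cINF_lower[OF bdd]) simp
  show upper: "G x \<le> F x" for x using le[of x x] by simp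
  have "- C \<le> G x" unfolding G_def
  proof (rule cINF_greatest)
    fix y show "- C \<le> F y + k * dist x y"
      using C[of y] k mult_nonneg_nonneg[OF k zero_le_dist[of x y]] by linarith
  qed simp
  then show "\<bar>G x\<bar> \<le> C" using upper[of x] C[of x] by linarith
  have half: "G x \<le> G y + k * dist x y" for x y
  proof -
    have triangle: "G x - k * dist x y \<le> F z + k * dist y z" for z
    proof -
      have "k * dist x z \<le> k * dist x y + k * dist y z"
        using mult_left_mono[OF dist_triangle[of x z y] k] by (simp add: algebra_simps)
      then show ?thesis using le[of x z] by linarith
    qed
    have "G x - k * dist x y \<le> (INF z. F z + k * dist y z)"
      by (rule cINF_greatest) (simp_all add: triangle)
    then show ?thesis by (simp add: G_def)
  qed
  show "k-lipschitz_on UNIV G"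
  proof (rule lipschitz_onI)
    fix x y show "dist (G x) (G y) \<le> k * dist x y"
      using half[of x y] half[of y x] by (simp add: dist_real_def dist_commute abs_le_iff)
  qed (rule k)
qed

text \<open>Near \<open>x\<close>, continuity keeps \<open>F y\<close> close to \<open>F x\<close>.
  Away from \<open>x\<close>, the penalty is at least \<open>2 * C\<close> for large
  \<open>k\<close>, which covers the whole oscillation of \<open>F\<close>, so such points cannot
  push the infimum below \<open>F x\<close>.\<close>

lemma inf_convolution_tendsto:
  fixes F :: "'a::metric_space \<Rightarrow> real"
  assumes C: "\<And>x. \<bar>F x\<bar> \<le> C" and F: "isCont F x"
  shows "(\<lambda>k. INF y. F y + real k * dist x y) \<longlonglongrightarrow> F x"
proof (rule LIMSEQ_I)
  fix e :: real assume e: "0 < e"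
  obtain d where d: "0 < d" "\<And>y. dist y x < d \<Longrightarrow> dist (F y) (F x) < e / 2"
    using F e unfolding continuous_at_eps_delta by (metis half_gt_zero)
  obtain k0 where k0: "2 * C / d \<le> real k0" using real_arch_simple by blast
  show "\<exists>k0. \<forall>k\<ge>k0. norm ((INF y. F y + real k * dist x y) - F x) < e"
  proof (intro exI[of _ k0] allI impI)
    fix k assume "k0 \<le> k"
    with k0 have k: "2 * C \<le> real k * d" using d(1)
      by (meson divide_le_eq of_nat_le_iff order_trans)
    have "F x - e / 2 \<le> F y + real k * dist x y" for y
    proof (cases "dist x y < d")
      case True
      then have "\<bar>F y - F x\<bar> < e / 2" using d(2)[of y] unfolding dist_real_def by (metis dist_commute)
      moreover have "0 \<le> real k * dist x y" by simp
      ultimately show ?thesis by linarith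
    next
      case False
      then have "real k * d \<le> real k * dist x y" by (intro mult_left_mono) auto
      then show ?thesis using k C[of x] C[of y] e by linarith
    qed
    then have "F x - e / 2 \<le> (INF y. F y + real k * dist x y)" by (intro cINF_greatest) simp_all
    then show "norm ((INF y. F y + real k * dist x y) - F x) < e"
      using inf_convolution_lipschitz(3)[where F = F and k = "real k" and x = x, OF C] e by simp
  qed
qed

text \<open>The inf-convolutions are Lipschitz minorants increasing to \<open>F\<close>; apply this to \<open>F\<close> and \<open>- F\<close>.\<close>

lemma weakly_converges_if_lipschitz:
  fixes Q :: "'a::metric_space measure"
  assumes P: "\<And>n. prob_space (P n)" "\<And>n. sets (P n) = sets borel"
    and Q: "prob_space Q" "sets Q = sets borel"
    and lip: "\<And>(F :: 'a \<Rightarrow> real) L. L-lipschitz_on UNIV F \<Longrightarrow> bounded (range F) \<Longrightarrow>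
      (\<lambda>n. LINT w|P n. F w) \<longlonglongrightarrow> (LINT w|Q. F w)"
  shows "weakly_converges P Q"
proof -
  have int: "integrable R F"
    if "prob_space R" "sets R = sets borel" "continuous_on UNIV F" "\<And>x. \<bar>F x\<bar> \<le> C"
    for R and F :: "'a \<Rightarrow> real" and C
  proof -
    interpret prob_space R by fact
    have "F \<in> borel_measurable R"
      using borel_measurable_continuous_onI[OF that(3)] measurable_cong_sets[OF that(2) refl] by blast
    then show ?thesis using that(4) by (intro integrable_const_bound[of _ C]) auto
  qed
  \<comment> \<open>The order of limits matters: \<open>k\<close> is fixed first, by dominated
    convergence under \<open>Q\<close>, and only then does \<open>n\<close> grow, so
    \<open>lip\<close> is applied to a single function \<open>G k\<close>.\<close>
  have lower: "\<forall>\<^sub>F n in sequentially. (LINT w|Q. F w) - e < (LINT w|P n. F w)"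
    if cont: "continuous_on UNIV F" and C: "\<And>x. \<bar>F x\<bar> \<le> C" and e: "0 < e"
    for F :: "'a \<Rightarrow> real" and C e
  proof -
    define G where "G k x = (INF y. F y + real k * dist x y)" for k x
    have G: "(real k)-lipschitz_on UNIV (G k)" "\<bar>G k x\<bar> \<le> C" "G k x \<le> F x" for k x
      using inf_convolution_lipschitz[where F = F and k = "real k", OF C] unfolding G_def by auto
    have cG: "continuous_on UNIV (G k)" for k by (rule lipschitz_on_continuous_on[OF G(1)])
    have mQ: "f \<in> borel_measurable Q" if "continuous_on UNIV f" for f :: "'a \<Rightarrow> real"
      using borel_measurable_continuous_onI[OF that] measurable_cong_sets[OF Q(2) refl] by blast
    interpret Q: prob_space Q by fact
    have "(\<lambda>k. LINT w|Q. G k w) \<longlonglongrightarrow> (LINT w|Q. F w)"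
    proof (rule integral_dominated_convergence[where w = "\<lambda>_. C"])
      show "AE w in Q. (\<lambda>k. G k w) \<longlonglongrightarrow> F w"
        unfolding G_def using inf_convolution_tendsto[where F = F, OF C] cont
        by (auto simp: continuous_on_eq_continuous_at)
    qed (use mQ cont cG G(2) in auto)
    then have "\<forall>\<^sub>F k in sequentially. (LINT w|Q. F w) - e < (LINT w|Q. G k w)"
      by (rule order_tendstoD) (use e in simp)
    then obtain k where k: "(LINT w|Q. F w) - e < (LINT w|Q. G k w)"
      by (auto simp: eventually_sequentially)
    have "bounded (range (G k))" by (rule boundedI[of _ C]) (use G(2) in auto)
    from order_tendstoD(1)[OF lip[OF G(1) this] k] show ?thesis
    proof eventually_elim
      case (elim n)
      have "(LINT w|P n. G k w) \<le> (LINT w|P n. F w)"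
        by (intro integral_mono int[OF P cG G(2)] int[OF P cont C] G(3))
      with elim show ?case by simp
    qed
  qed
  show ?thesis
    unfolding weakly_converges_def
  proof (intro allI impI, elim conjE)
    fix F :: "'a \<Rightarrow> real" assume cont: "continuous_on UNIV F" and "bounded (range F)"
    then obtain C where C: "\<And>x. \<bar>F x\<bar> \<le> C" by (auto simp: bounded_iff)
    show "(\<lambda>n. LINT w|P n. F w) \<longlonglongrightarrow> (LINT w|Q. F w)"
    proof (rule tendstoI)
      fix e :: real assume e: "0 < e"
      from lower[OF cont C e] lower[of "\<lambda>x. - F x" C e] cont C e
      have "\<forall>\<^sub>F n in sequentially. (LINT w|Q. F w) - e < (LINT w|P n. F w)"
        "\<forall>\<^sub>F n in sequentially. (LINT w|Q. - F w) - e < (LINT w|P n. - F w)"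
        by (auto intro: continuous_on_minus)
      then show "\<forall>\<^sub>F n in sequentially. dist (LINT w|P n. F w) (LINT w|Q. F w) < e"
        by eventually_elim (auto simp: dist_real_def)
    qed
  qed
qed

section \<open>Comparison of L^p with L^1\<close>

text \<open>Total mass 1 puts the L^1 norm below every other L^p norm. For finite exponents, Young's
  inequality rescaled by a level \<open>c\<close> above the norm is integrated directly, in place of
  Hoelder's inequality.\<close>

lemma (in prob_space) integral_norm_le_Lp_norm:
  fixes f :: "'a \<Rightarrow> 'b::{banach, second_countable_topology}"
  assumes p: "1 \<le> p" and f: "f \<in> Lp p M"
  shows "integrable M f" and "(LINT x|M. norm (f x)) \<le> Lp_norm p M f"
proof -
  have [measurable]: "f \<in> borel_measurable M" using f by (simp add: Lp_def)
  have "integrable M f \<and> (LINT x|M. norm (f x)) \<le> Lp_norm p M f"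
  proof (cases "p = \<infinity>")
    case True
    let ?E = "esssup M (\<lambda>x. ereal (norm (f x)))"
    \<comment> \<open>\<open>real_of_ereal\<close> sends both infinities to 0, so \<open>?E\<close>
      must be bounded on both sides before it can be identified with \<open>Lp_norm p M f\<close>.
      The lower bound rests on the space not being null.\<close>
    have "esssup M (\<lambda>x. 0) \<le> ?E" by (rule esssup_mono) auto
    then have "0 \<le> ?E" by (simp add: esssup_const emeasure_space_1)
    moreover have "?E < \<infinity>" using f True by (simp add: Lp_def)
    ultimately have E: "?E = ereal (Lp_norm p M f)"
      using True by (cases ?E) (auto simp: Lp_norm_def)
    have AE: "AE x in M. norm (f x) \<le> Lp_norm p M f"
      using esssup_AE[of "\<lambda>x. ereal (norm (f x))" M] unfolding E by simp
    have "integrable M f" by (rule integrable_const_bound[OF AE]) simp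
    moreover have "(LINT x|M. norm (f x)) \<le> (LINT x|M. Lp_norm p M f)"
      using AE calculation by (intro integral_mono_AE) auto
    ultimately show ?thesis by (simp add: prob_space)
  next
    case False
    define a where "a = enn2real p"
    have a: "1 \<le> a"
      using p False unfolding a_def
      by (cases p) (auto simp flip: ennreal_1)
    have int: "integrable M (\<lambda>x. norm (f x) powr a)"
      using f False by (simp add: Lp_def a_def)
    define A where "A = (LINT x|M. norm (f x) powr a)"
    have A: "0 \<le> A" unfolding A_def by simp
    have nm: "Lp_norm p M f = A powr (1 / a)" using False by (simp add: Lp_norm_def a_def A_def)
    \<comment> \<open>Young's inequality for \<open>(norm (f x) / c) powr a\<close> and \<open>1\<close>, with weights \<open>1 / a\<close> and \<open>1 - 1 / a\<close>\<close>
    have young: "norm (f x) \<le> c * (1 / a * (norm (f x) powr a / c powr a) + (1 - 1 / a))"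
      if c: "0 < c" for c x
    proof (cases "f x = 0")
      case True
      then show ?thesis using a c by simp
    next
      case False
      have "((norm (f x) / c) powr a) powr (1 / a) * 1 powr (1 - 1 / a)
          \<le> 1 / a * (norm (f x) / c) powr a + (1 - 1 / a) * 1"
        using a c False by (intro Youngs_inequality_0) auto
      then have "norm (f x) / c \<le> 1 / a * (norm (f x) powr a / c powr a) + (1 - 1 / a)"
        using a c False by (simp add: powr_powr powr_divide)
      then show ?thesis using c by (simp add: field_simps)
    qed
    have intc: "integrable M (\<lambda>x. c * (1 / a * (norm (f x) powr a / c powr a) + (1 - 1 / a)))" for c
      using int by (auto intro!: integrable_mult_right integrable_add integrable_divide)
    have intf: "integrable M f"
    proof (rule Bochner_Integration.integrable_bound[OF intc[of 1]])
      show "AE x in M. norm (f x) \<le> norm (1 * (1 / a * (norm (f x) powr a / 1 powr a) + (1 - 1 / a)))"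
        using young[of 1] by (auto intro: order_trans[OF _ abs_ge_self])
    qed simp
    \<comment> \<open>A level strictly above the norm is positive even if \<open>A = 0\<close>, so
      dividing by it in \<open>young\<close> is legitimate; \<open>dense_ge\<close> then lets
      \<open>c\<close> decrease to the norm.\<close>
    have "(LINT x|M. norm (f x)) \<le> c" if c: "A powr (1 / a) < c" for c
    proof -
      have c0: "0 < c" using c powr_ge_zero[of A "1 / a"] by linarith
      have "(LINT x|M. norm (f x)) \<le> (LINT x|M. c * (1 / a * (norm (f x) powr a / c powr a) + (1 - 1 / a)))"
        using young[OF c0] intc intf by (intro integral_mono) auto
      also have "\<dots> = c * (1 / a * (A / c powr a) + (1 - 1 / a))"
        using int by (simp add: A_def prob_space)
      also have "\<dots> \<le> c * (1 / a * 1 + (1 - 1 / a))"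
      proof -
        have "A = (A powr (1 / a)) powr a" using A a by (simp add: powr_powr)
        also have "\<dots> \<le> c powr a" using a c by (intro powr_mono2) auto
        finally have "A / c powr a \<le> 1" using c0 by simp
        then show ?thesis using a c0 by (intro mult_left_mono add_mono) auto
      qed
      finally show ?thesis by simp
    qed
    then have "(LINT x|M. norm (f x)) \<le> A powr (1 / a)" by (rule dense_ge)
    then show ?thesis using intf nm by simp
  qed
  then show "integrable M f" "(LINT x|M. norm (f x)) \<le> Lp_norm p M f" by auto
qed

text \<open>Membership asks only for finiteness, so for finite exponents the crude bound of the
  difference by twice the larger norm replaces Minkowski's inequality.\<close>

lemma Lp_diff:
  fixes f h :: "'e \<Rightarrow> 'b::{banach, second_countable_topology}"
  assumes f: "f \<in> Lp p M" and h: "h \<in> Lp p M"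
  shows "(\<lambda>x. f x - h x) \<in> Lp p M"
proof -
  have [measurable]: "f \<in> borel_measurable M" "h \<in> borel_measurable M"
    using f h by (simp_all add: Lp_def)
  show ?thesis
  proof (cases "p = \<infinity>")
    case True
    have "esssup M (\<lambda>x. ereal (norm (f x - h x)))
        \<le> esssup M (\<lambda>x. ereal (norm (f x)) + ereal (norm (h x)))"
      by (rule esssup_mono) (auto intro: norm_triangle_ineq4)
    also have "\<dots> \<le> esssup M (\<lambda>x. ereal (norm (f x))) + esssup M (\<lambda>x. ereal (norm (h x)))"
      by (rule esssup_add)
    also have "\<dots> < \<infinity>" using f h True by (simp add: Lp_def)
    finally show ?thesis using True by (simp add: Lp_def)
  next
    case False
    let ?a = "enn2real p"
    have "integrable M (\<lambda>x. 2 powr ?a * (norm (f x) powr ?a + norm (h x) powr ?a))"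
      using f h False by (simp add: Lp_def)
    then have "integrable M (\<lambda>x. norm (f x - h x) powr ?a)"
    proof (rule Bochner_Integration.integrable_bound)
      have "norm (f x - h x) powr ?a \<le> 2 powr ?a * (norm (f x) powr ?a + norm (h x) powr ?a)" for x
      proof -
        let ?m = "max (norm (f x)) (norm (h x))"
        have "norm (f x - h x) \<le> 2 * ?m"
          using norm_triangle_ineq4[of "f x" "h x"] by linarith
        then have "norm (f x - h x) powr ?a \<le> (2 * ?m) powr ?a" by (intro powr_mono2) auto
        also have "\<dots> = 2 powr ?a * ?m powr ?a" by (simp add: powr_mult)
        also have "\<dots> \<le> 2 powr ?a * (norm (f x) powr ?a + norm (h x) powr ?a)"
          by (intro mult_left_mono) (auto simp: max_def)
        finally show ?thesis .
      qed
      then show "AE x in M. norm (norm (f x - h x) powr ?a)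
          \<le> norm (2 powr ?a * (norm (f x) powr ?a + norm (h x) powr ?a))"
        by auto
    qed simp
    then show ?thesis using False by (simp add: Lp_def)
  qed
qed

section \<open>Stability of partial sum paths in the Skorokhod metric\<close>

text \<open>The identity time change suffices: at every time the paths differ by at most the first
  \<open>k\<close> discrepancies, tapering only shrinks this, and the weights in
  \<open>dist_cadlag\<close> add up to 1. The bound is uniform in \<open>n\<close>, so the factor
  \<open>c = 1 / b n\<close> will make it vanish.\<close>

lemma dist_scale_sum_path_le:
  fixes a a' :: "nat \<Rightarrow> 'a::real_normed_vector"
  assumes eq: "\<And>j. k \<le> j \<Longrightarrow> a j = a' j"
  shows "dist (scale_path c (sum_path n a)) (scale_path c (sum_path n a'))
    \<le> \<bar>c\<bar> * (\<Sum>j<k. norm (a j - a' j))" (is "dist ?x ?y \<le> ?e")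
proof -
  have e: "0 \<le> ?e" by (simp add: sum_nonneg)
  have path: "norm (path_at ?x t - path_at ?y t) \<le> ?e" for t
  proof -
    let ?m = "nat \<lfloor>real n * t\<rfloor>"
    have "norm (\<Sum>j<?m. a j - a' j) \<le> (\<Sum>j<?m. norm (a j - a' j))" by (rule norm_sum)
    also have "\<dots> = (\<Sum>j\<in>{..<?m} \<inter> {..<k}. norm (a j - a' j))"
      by (rule sum.mono_neutral_right) (auto, metis eq linorder_not_less)
    also have "\<dots> \<le> (\<Sum>j<k. norm (a j - a' j))" by (rule sum_mono2) auto
    finally show ?thesis
      by (simp add: scale_path.rep_eq sum_path.rep_eq sum_subtractf mult_left_mono flip: scaleR_diff_right)
  qed
  have upto: "skorokhod_dist_upto N ?x ?y \<le> ?e" for N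
  proof (intro skorokhod_dist_upto_le, unfold skorokhod_within_def,
      intro bexI[OF _ id_in_time_changes] allI impI conjI)
    fix t :: real
    show "\<bar>t - t\<bar> \<le> ?e" using e by simp
    have "norm (taper N t *\<^sub>R path_at ?x t - taper N t *\<^sub>R path_at ?y t)
        = \<bar>taper N t\<bar> * norm (path_at ?x t - path_at ?y t)"
      by (simp flip: scaleR_diff_right)
    also have "\<dots> \<le> 1 * ?e" by (intro mult_mono path) (auto simp: taper_def)
    finally show "norm (taper N t *\<^sub>R path_at ?x t - taper N t *\<^sub>R path_at ?y t) \<le> ?e" by simp
  qed
  have "dist ?x ?y \<le> (\<Sum>N. (1/2) ^ Suc N * ?e)"
    unfolding dist_cadlag_def
    by (intro suminf_le summable_dist_cadlag mult_left_mono upto summable_mult2)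
      (auto intro: sums_summable[OF power_half_series])
  also have "\<dots> = (\<Sum>N. (1/2) ^ Suc N) * ?e"
    by (intro suminf_mult2[symmetric] sums_summable[OF power_half_series])
  also have "\<dots> = ?e" using sums_unique[OF power_half_series] by simp
  finally show ?thesis .
qed

section \<open>Usable forms of the closure and decay assumptions\<close>

lemma (in prob_space) Lp_norm_infinity_bounds:
  fixes f :: "'a \<Rightarrow> 'b::real_normed_vector"
  assumes [measurable]: "f \<in> borel_measurable M" and C: "\<And>x. norm (f x) \<le> C"
  shows "0 \<le> Lp_norm \<infinity> M f" and "Lp_norm \<infinity> M f \<le> C"
proof -
  let ?E = "esssup M (\<lambda>x. ereal (norm (f x)))"
  have "esssup M (\<lambda>x. 0) \<le> ?E" by (rule esssup_mono) auto
  then have "0 \<le> ?E" by (simp add: esssup_const emeasure_space_1)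
  moreover have "?E \<le> ereal C" by (rule esssup_I) (use C in auto)
  ultimately show "0 \<le> Lp_norm \<infinity> M f" "Lp_norm \<infinity> M f \<le> C"
    by (cases ?E; simp add: Lp_norm_def)+
qed

text \<open>After this reduction only L^1 approximation matters. Intersecting \<open>A\<close> with
  \<open>Lp p M\<close> puts the difference into \<open>Lp p M\<close>; otherwise a default value 0
  of the integral or of \<open>real_of_ereal\<close> could make \<open>Lp_norm\<close> small without
  any closeness.\<close>

lemma (in prob_space) Lp_closure_L1_approx:
  fixes f :: "'a \<Rightarrow> 'b::{banach, second_countable_topology}"
  assumes p: "1 \<le> p" and f: "f \<in> Lp_closure p M (A \<inter> Lp p M)" and e: "0 < e"
  obtains s where "s \<in> A" "(LINT x|M. norm (f x - s x)) < e"
proof -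
  obtain s where s: "s \<in> A" "s \<in> Lp p M" "Lp_norm p M (\<lambda>x. f x - s x) < e" and "f \<in> Lp p M"
    using f e unfolding Lp_closure_def by blast
  then have "(LINT x|M. norm (f x - s x)) < e"
    using integral_norm_le_Lp_norm(2)[OF p Lp_diff] by fastforce
  with s(1) that show ?thesis by blast
qed

lemma measurable_tail_map:
  assumes X: "\<And>j. X j \<in> measurable M (N j)"
  shows "tail_map X n \<in> measurable M (tail_space N n)"
  unfolding tail_map_def tail_space_def
  by (intro measurable_PiM_single') (auto intro: X simp: measurable_space[OF X])

text \<open>A real test function is embedded into the complex ones, and its essential supremum is
  replaced by the uniform bound \<open>C\<close>. Passing to \<open>\<bar>\<delta> n\<bar>\<close>
  makes the right-hand side monotone in its other factors.\<close>

lemma decay_of_correlationsD: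
  assumes M: "prob_space M" and X: "\<And>j. X j \<in> measurable M (N j)"
    and DC: "decay_of_correlations M N X B nrm \<delta>" and s: "s \<in> B"
    and f: "f \<in> borel_measurable (tail_space N n)" and C: "\<And>y. \<bar>f y\<bar> \<le> C"
  shows "\<bar>(LINT x|M. s x * f (tail_map X n x)) - (LINT x|M. s x) * (LINT x|M. f (tail_map X n x))\<bar>
    \<le> nrm s * C * \<bar>\<delta> n\<bar>"
proof -
  interpret prob_space M by fact
  have tm: "tail_map X n \<in> measurable M (tail_space N n)"
    by (rule measurable_tail_map[OF X])
  let ?f = "\<lambda>y. complex_of_real (f y)"
  have m: "?f \<in> borel_measurable (tail_space N n)" using f by simp
  have m': "(\<lambda>x. ?f (tail_map X n x)) \<in> borel_measurable M" by (rule measurable_compose[OF tm m])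
  have b: "bounded (?f ` space (tail_space N n))" by (rule boundedI[of _ C]) (use C in auto)
  have ns: "0 \<le> nrm s" using DC s by (auto simp: decay_of_correlations_def)
  have "cmod ((LINT x|M. of_real (s x) * ?f (tail_map X n x))
              - of_real (LINT x|M. s x) * (LINT x|M. ?f (tail_map X n x)))
        \<le> nrm s * Lp_norm \<infinity> M (\<lambda>x. ?f (tail_map X n x)) * \<delta> n"
    using DC s m b unfolding decay_of_correlations_def by blast
  also have "\<dots> \<le> nrm s * Lp_norm \<infinity> M (\<lambda>x. ?f (tail_map X n x)) * \<bar>\<delta> n\<bar>"
    using Lp_norm_infinity_bounds(1)[OF m', of C] C ns by (intro mult_left_mono) auto
  also have "\<dots> \<le> nrm s * C * \<bar>\<delta> n\<bar>"
    using Lp_norm_infinity_bounds(2)[OF m', of C] C ns by (intro mult_right_mono mult_left_mono) auto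
  finally show ?thesis
    by (simp flip: of_real_mult of_real_diff)
qed

section \<open>Asymptotic independence of the density and the process\<close>

text \<open>The choices come in the order \<open>s\<close> from the accuracy, \<open>k\<close> from
  \<open>s\<close>, and \<open>n\<close> last. Since \<open>k\<close> stays fixed while
  \<open>n\<close> grows, no rate for \<open>\<delta>\<close> enters.\<close>

lemma asymptotic_independence:
  fixes g :: "nat \<Rightarrow> (nat \<Rightarrow> 'x) \<Rightarrow> 'a::{real_normed_vector, second_countable_topology}"
    and F :: "'a cadlag \<Rightarrow> real" and r :: "'e \<Rightarrow> real"
  assumes M: "prob_space M"
    and X: "\<And>j. X j \<in> measurable M (N j)"
    and DC: "decay_of_correlations M N X B nrm \<delta>"
    and g: "\<And>j. g j \<in> borel_measurable (tail_space N j)"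
    and r: "integrable M r" "(LINT x|M. r x) = 1"
    and approx: "\<And>e. 0 < e \<Longrightarrow> \<exists>s\<in>B. (LINT x|M. \<bar>r x - s x\<bar>) < e"
    and b: "filterlim b at_top sequentially"
    and F: "L-lipschitz_on UNIV F" and C: "\<And>w. \<bar>F w\<bar> \<le> C"
  defines "Z \<equiv> \<lambda>n x. scale_path (1 / b n) (partial_sum_process X g n x)"
  shows "(\<lambda>n. (LINT x|M. r x * F (Z n x)) - (LINT x|M. F (Z n x))) \<longlonglongrightarrow> 0"
proof (rule tendstoI)
  fix e :: real assume e: "0 < e"
  interpret prob_space M by fact
  have C0: "0 \<le> C" using C[of undefined] by linarith
  \<comment> \<open>The five errors collected below add up to at most
    \<open>2 * \<eta> * C + 3 * \<eta>\<close>, which is less than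
    \<open>4 * \<eta> * (C + 1) = e\<close>. The \<open>+ 1\<close> keeps the denominator positive
    when \<open>C = 0\<close>.\<close>
  define \<eta> where "\<eta> = e / (4 * (C + 1))"
  have \<eta>: "0 < \<eta>" "4 * (\<eta> * (C + 1)) = e" using e C0 by (auto simp: \<eta>_def divide_simps)
  obtain s where s: "s \<in> B" "(LINT x|M. \<bar>r x - s x\<bar>) < \<eta>" using approx[OF \<eta>(1)] by blast
  have ints: "integrable M s" using DC s(1) by (auto simp: decay_of_correlations_def)
  have "(\<lambda>k. nrm s * C * \<bar>\<delta> k\<bar>) \<longlonglongrightarrow> 0"
    using DC by (intro tendsto_mult_right_zero tendsto_rabs_zero) (simp add: decay_of_correlations_def)
  then have "\<forall>\<^sub>F k in sequentially. nrm s * C * \<bar>\<delta> k\<bar> < \<eta>"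
    by (rule order_tendstoD) (rule \<eta>)
  then obtain k where k: "nrm s * C * \<bar>\<delta> k\<bar> < \<eta>" by (auto simp: eventually_sequentially)
  \<comment> \<open>\<open>W\<close> lives on sequences, so that (DC) can be applied to it. With
    \<open>y = tail_map X k x\<close>, entry \<open>j - k + i\<close> of \<open>y\<close> is
    \<open>X (j + i) x\<close>, so for \<open>j \<ge> k\<close> the function \<open>g j\<close>
    receives exactly \<open>tail_map X j x\<close>.\<close>
  define W where "W n y = scale_path (1 / b n)
    (sum_path n (\<lambda>j. if j < k then 0 else g j (\<lambda>i. y (j - k + i))))" for n and y :: "nat \<Rightarrow> 'x"
  let ?W = "\<lambda>n x. W n (tail_map X k x)"
  have cF: "continuous_on UNIV F" by (rule lipschitz_on_continuous_on[OF F])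
  have mF: "F \<in> borel_measurable borel" by (rule borel_measurable_continuous_onI[OF cF])
  have mW: "W n \<in> borel_measurable (tail_space N k)" for n
  proof -
    have gm: "(\<lambda>y. g j (\<lambda>i. y (j - k + i))) \<in> borel_measurable (tail_space N k)" if "k \<le> j" for j
    proof (rule measurable_compose[OF _ g])
      have "(\<lambda>y. y (j - k + i)) \<in> measurable (tail_space N k) (N (j + i))" for i
        using measurable_component_singleton[of "j - k + i" UNIV "\<lambda>i. N (k + i)"] that
        by (simp add: tail_space_def)
      then show "(\<lambda>y i. y (j - k + i)) \<in> measurable (tail_space N k) (tail_space N j)"
        unfolding tail_space_def[of N j]
        by (intro measurable_PiM_single') (auto dest: measurable_space)
    qed
    have "(\<lambda>y. if j < k then 0 else g j (\<lambda>i. y (j - k + i))) \<in> borel_measurable (tail_space N k)" for j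
      using gm[of j] by (cases "j < k") simp_all
    then have "(\<lambda>y j. if j < k then 0 else g j (\<lambda>i. y (j - k + i)))
        \<in> measurable (tail_space N k) (\<Pi>\<^sub>M j\<in>UNIV. borel)"
      by (intro measurable_PiM_single') auto
    \<comment> \<open>For a countable product of second countable spaces the product sigma-algebra
      is the Borel one, so continuity of the path map yields measurability.\<close>
    then have "(\<lambda>y j. if j < k then 0 else g j (\<lambda>i. y (j - k + i)))
        \<in> borel_measurable (tail_space N k)"
      using measurable_cong_sets[OF refl sets_PiM_equal_borel] by blast
    from measurable_compose[OF this borel_measurable_continuous_onI[OF continuous_scale_sum_path]]
    show ?thesis by (simp add: W_def[abs_def])
  qed
  have tm: "tail_map X k \<in> measurable M (tail_space N k)"
    by (rule measurable_tail_map[OF X])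
  have mZ [measurable]: "(\<lambda>x. F (Z n x)) \<in> borel_measurable M" for n
    unfolding Z_def by (rule measurable_compose[OF partial_sum_process_measurable[OF X g] mF])
  have mFW: "(\<lambda>y. F (W n y)) \<in> borel_measurable (tail_space N k)" for n
    by (rule measurable_compose[OF mW mF])
  have mW' [measurable]: "(\<lambda>x. F (?W n x)) \<in> borel_measurable M" for n
    by (rule measurable_compose[OF tm mFW])
  have close: "(\<lambda>n. F (Z n x) - F (?W n x)) \<longlonglongrightarrow> 0" for x
  proof (rule Lim_null_comparison)
    \<comment> \<open>\<open>?S\<close> is the total size of the deleted summands, the
      \<open>0\<close> being their replacement in \<open>W\<close>. It depends on \<open>x\<close>
      but not on \<open>n\<close>, so the convergence is pointwise and dominated convergence must
      follow.\<close>
    let ?S = "\<Sum>j<k. norm (g j (tail_map X j x) - 0)"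
    show "\<forall>\<^sub>F n in sequentially. norm (F (Z n x) - F (?W n x)) \<le> L * (\<bar>1 / b n\<bar> * ?S)"
    proof (intro always_eventually allI)
      fix n
      have "dist (Z n x) (?W n x) \<le> \<bar>1 / b n\<bar> * ?S"
        unfolding Z_def W_def partial_sum_process_def
        by (rule order_trans[OF dist_scale_sum_path_le[where k = k]])
          (auto simp: tail_map_def)
      then have "L * dist (Z n x) (?W n x) \<le> L * (\<bar>1 / b n\<bar> * ?S)"
        using lipschitz_on_nonneg[OF F] by (rule mult_left_mono)
      with lipschitz_onD[OF F, of "Z n x" "?W n x"]
      show "norm (F (Z n x) - F (?W n x)) \<le> L * (\<bar>1 / b n\<bar> * ?S)"
        by (simp add: dist_real_def)
    qed
    have "(\<lambda>n. 1 / b n) \<longlonglongrightarrow> 0"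
      by (rule tendsto_divide_0[OF tendsto_const filterlim_at_top_imp_at_infinity[OF b]])
    then show "(\<lambda>n. L * (\<bar>1 / b n\<bar> * ?S)) \<longlonglongrightarrow> 0"
      by (intro tendsto_mult_right_zero tendsto_mult_left_zero tendsto_rabs_zero)
  qed
  \<comment> \<open>Applied with \<open>h = r\<close> and with \<open>h = 1\<close>, to pass from
    \<open>Z\<close> to \<open>W\<close> in both integrals.\<close>
  have small: "(\<lambda>n. LINT x|M. h x * (F (Z n x) - F (?W n x))) \<longlonglongrightarrow> 0" if h: "integrable M h" for h
  proof -
    have [measurable]: "h \<in> borel_measurable M" using h by auto
    have "(\<lambda>n. LINT x|M. h x * (F (Z n x) - F (?W n x))) \<longlonglongrightarrow> (LINT x|M. 0)"
    proof (rule integral_dominated_convergence[where w = "\<lambda>x. \<bar>h x\<bar> * (2 * C)"])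
      show "AE x in M. (\<lambda>n. h x * (F (Z n x) - F (?W n x))) \<longlonglongrightarrow> 0"
        by (intro AE_I2 tendsto_mult_right_zero close)
      have "\<bar>F (Z n x) - F (?W n x)\<bar> \<le> 2 * C" for n x
        using C[of "Z n x"] C[of "?W n x"] by linarith
      then show "AE x in M. norm (h x * (F (Z n x) - F (?W n x))) \<le> \<bar>h x\<bar> * (2 * C)" for n
        by (auto simp: abs_mult intro!: mult_left_mono)
    qed (use h in auto)
    then show ?thesis by simp
  qed
  have int: "integrable M (\<lambda>x. h x * F (f x))"
    if "integrable M h" "(\<lambda>x. F (f x)) \<in> borel_measurable M" for h and f :: "'e \<Rightarrow> 'a cadlag"
  proof (rule Bochner_Integration.integrable_bound[where f = "\<lambda>x. C * h x"])
    show "AE x in M. norm (h x * F (f x)) \<le> norm (C * h x)"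
      using C C0 by (auto simp: abs_mult mult.commute[of C] intro!: mult_left_mono)
  qed (use that in auto)
  have one: "integrable M (\<lambda>x. 1 :: real)" by simp
  \<comment> \<open>(DC) produces the factor \<open>LINT x|M. s x\<close>, whereas the claim
    involves the integral 1 of \<open>r\<close>.\<close>
  have close_s: "\<bar>(LINT x|M. s x) - 1\<bar> \<le> \<eta>"
  proof -
    have "(LINT x|M. s x) - 1 = (LINT x|M. s x - r x)" using ints r by simp
    also have "\<bar>\<dots>\<bar> \<le> (LINT x|M. \<bar>s x - r x\<bar>)" by (rule integral_abs_bound)
    finally show ?thesis using s(2) by (simp add: abs_minus_commute)
  qed
  have "\<forall>\<^sub>F n in sequentially. \<bar>LINT x|M. r x * (F (Z n x) - F (?W n x))\<bar> < \<eta> \<and>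
      \<bar>LINT x|M. 1 * (F (Z n x) - F (?W n x))\<bar> < \<eta>"
    using tendstoD[OF small[OF r(1)] \<eta>(1)] tendstoD[OF small[OF one] \<eta>(1)]
    by eventually_elim (simp add: dist_real_def)
  then show "\<forall>\<^sub>F n in sequentially.
      dist ((LINT x|M. r x * F (Z n x)) - (LINT x|M. F (Z n x))) 0 < e"
  proof eventually_elim
    case (elim n)
    let ?I = "LINT x|M. F (?W n x)"
    have 1: "(LINT x|M. r x * (F (Z n x) - F (?W n x)))
        = (LINT x|M. r x * F (Z n x)) - (LINT x|M. r x * F (?W n x))"
      using int[OF r(1) mZ] int[OF r(1) mW'] by (simp add: right_diff_distrib)
    have 2: "(LINT x|M. 1 * (F (Z n x) - F (?W n x))) = (LINT x|M. F (Z n x)) - ?I"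
      using int[OF one mZ] int[OF one mW'] by simp
    \<comment> \<open>With \<open>W\<close> in place of \<open>Z\<close>, three replacements remain:
      \<open>r\<close> by \<open>s\<close> in \<open>3\<close>, the integral of the product by the
      product of integrals in \<open>4\<close>, and the mean of \<open>s\<close> by 1 in
      \<open>5\<close>.\<close>
    have "\<bar>(LINT x|M. r x * F (?W n x)) - (LINT x|M. s x * F (?W n x))\<bar>
        = \<bar>LINT x|M. (r x - s x) * F (?W n x)\<bar>"
      using int[OF r(1) mW'] int[OF ints mW'] by (simp add: left_diff_distrib)
    also have "\<dots> \<le> (LINT x|M. \<bar>(r x - s x) * F (?W n x)\<bar>)" by (rule integral_abs_bound)
    also have "\<dots> \<le> (LINT x|M. \<bar>r x - s x\<bar> * C)"
    proof (rule integral_mono)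
      show "integrable M (\<lambda>x. \<bar>(r x - s x) * F (?W n x)\<bar>)"
        using r(1) ints by (intro integrable_abs int mW') auto
      show "integrable M (\<lambda>x. \<bar>r x - s x\<bar> * C)" using r(1) ints by auto
      show "\<bar>(r x - s x) * F (?W n x)\<bar> \<le> \<bar>r x - s x\<bar> * C" for x
        using C by (simp add: abs_mult mult_left_mono)
    qed
    also have "\<dots> \<le> \<eta> * C" using s(2) C0 by (simp add: mult_right_mono)
    finally have 3: "\<bar>(LINT x|M. r x * F (?W n x)) - (LINT x|M. s x * F (?W n x))\<bar> \<le> \<eta> * C" .
    have 4: "\<bar>(LINT x|M. s x * F (?W n x)) - (LINT x|M. s x) * ?I\<bar> \<le> \<eta>"
      using decay_of_correlationsD[OF M X DC s(1) mFW C, of n] k by simp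
    have "\<bar>?I\<bar> \<le> (LINT x|M. \<bar>F (?W n x)\<bar>)" by (rule integral_abs_bound)
    also have "\<dots> \<le> (LINT x|M. C)"
      using int[OF one mW'] C by (intro integral_mono) auto
    finally have "\<bar>?I\<bar> \<le> C" by (simp add: prob_space)
    with close_s have "\<bar>(LINT x|M. s x) - 1\<bar> * \<bar>?I\<bar> \<le> \<eta> * C"
      using \<eta>(1) by (intro mult_mono) auto
    then have 5: "\<bar>(LINT x|M. s x) * ?I - ?I\<bar> \<le> \<eta> * C"
      by (simp flip: abs_mult add: left_diff_distrib)
    have 6: "\<eta> * C * 2 + \<eta> * 3 < e"
      using \<eta> mult_nonneg_nonneg[of \<eta> C] C0 unfolding distrib_left by linarith
    show ?case using elim 3 4 5 6 unfolding 1 2 dist_real_def by linarith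
  qed
qed

section \<open>Passage between the two laws\<close>

text \<open>Expectations of Lipschitz test functions determine weak limits, so a vanishing
  difference of expectations carries \<open>Q\<close> over. \<open>M\<close> and \<open>M'\<close>
  enter symmetrically, and the lemma serves both directions.\<close>

lemma converges_in_distribution_transfer:
  fixes Z :: "nat \<Rightarrow> 'e \<Rightarrow> 'a::metric_space"
  assumes M: "prob_space M" and M': "prob_space M'" and sets: "sets M' = sets M"
    and conv: "converges_in_distribution M Z Q"
    and diff: "\<And>(F :: 'a \<Rightarrow> real) L. L-lipschitz_on UNIV F \<Longrightarrow> bounded (range F) \<Longrightarrow>
      (\<lambda>n. (LINT x|M'. F (Z n x)) - (LINT x|M. F (Z n x))) \<longlonglongrightarrow> 0"
  shows "converges_in_distribution M' Z Q"
proof -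
  have Q: "prob_space Q" "sets Q = sets borel" and Z: "Z n \<in> borel_measurable M"
    and w: "weakly_converges (\<lambda>n. distr M borel (Z n)) Q" for n
    using conv by (auto simp: converges_in_distribution_def)
  have Z': "Z n \<in> borel_measurable M'" for n
    using Z measurable_cong_sets[OF sets refl] by blast
  have "weakly_converges (\<lambda>n. distr M' borel (Z n)) Q"
  proof (rule weakly_converges_if_lipschitz[OF _ _ Q])
    show "prob_space (distr M' borel (Z n))" for n
      by (rule prob_space.prob_space_distr[OF M' Z'])
    fix F :: "'a \<Rightarrow> real" and L assume F: "L-lipschitz_on UNIV F" "bounded (range F)"
    have cF: "continuous_on UNIV F" by (rule lipschitz_on_continuous_on[OF F(1)])
    have mF: "F \<in> borel_measurable borel" by (rule borel_measurable_continuous_onI[OF cF])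
    have "(\<lambda>n. LINT x|M. F (Z n x)) \<longlonglongrightarrow> (LINT w|Q. F w)"
      using w cF F(2) unfolding weakly_converges_def integral_distr[OF Z mF, symmetric] by blast
    from tendsto_add[OF diff[OF F] this]
    show "(\<lambda>n. LINT w|distr M' borel (Z n). F w) \<longlonglongrightarrow> (LINT w|Q. F w)"
      by (simp add: integral_distr[OF Z' mF])
  qed simp
  with Q Z' show ?thesis by (simp add: converges_in_distribution_def)
qed

theorem theorem4p1:
  fixes M :: "'e measure"
    and N :: "nat \<Rightarrow> 'x measure"
    and X :: "nat \<Rightarrow> 'e \<Rightarrow> 'x"
    and B :: "('e \<Rightarrow> real) set"
    and nrm :: "('e \<Rightarrow> real) \<Rightarrow> real"
    and \<delta> b :: "nat \<Rightarrow> real"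
    and g :: "nat \<Rightarrow> (nat \<Rightarrow> 'x) \<Rightarrow> real ^ 'd"
    and r :: "'e \<Rightarrow> real"
    and p q :: ennreal
  assumes "prob_space M"
    and "\<And>j. X j \<in> measurable M (N j)"
    and "decay_of_correlations M N X B nrm \<delta>"
    and "\<And>j. g j \<in> borel_measurable (tail_space N j)"
    and "r \<in> borel_measurable M" and "\<And>x. x \<in> space M \<Longrightarrow> 0 \<le> r x"
    and "(LINT x|M. r x) = 1"
    and "1 / p + 1 / q = 1"
    and "r \<in> Lp_closure p M (B \<inter> Lp p M)"
    and "\<And>j. (\<lambda>x. g j (tail_map X j x)) \<in> Lp q M"
    and "\<And>n. 1 \<le> n \<Longrightarrow> 0 < b n" and "filterlim b at_top sequentially"
  shows "let \<nu> = density M (\<lambda>x. ennreal (r x));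
             Z = (\<lambda>n x. scale_path (1 / b n) (partial_sum_process X g n x))
         in (\<forall>Q. converges_in_distribution M Z Q \<longrightarrow> converges_in_distribution \<nu> Z Q) \<and>
            ((AE x in M. 0 < r x) \<longrightarrow>
               (\<forall>Q. converges_in_distribution \<nu> Z Q \<longrightarrow> converges_in_distribution M Z Q))"
proof -
  interpret prob_space M by fact
  define \<nu> where "\<nu> = density M (\<lambda>x. ennreal (r x))"
  define Z where "Z = (\<lambda>n x. scale_path (1 / b n) (partial_sum_process X g n x))"
  \<comment> \<open>A non-integrable function would have integral 0, not 1.\<close>
  have r: "integrable M r" using assms(7) not_integrable_integral_eq by fastforce
  have r0: "AE x in M. 0 \<le> r x" using assms(6) by simp
  have \<nu>: "prob_space \<nu>"
  proof (rule prob_spaceI)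
    have "emeasure \<nu> (space \<nu>) = (\<integral>\<^sup>+x. ennreal (r x) \<partial>M)"
      using assms(5) by (simp add: \<nu>_def emeasure_density cong: nn_integral_cong)
    then show "emeasure \<nu> (space \<nu>) = 1"
      using nn_integral_eq_integral[OF r r0] assms(7) by simp
  qed
  have sets: "sets \<nu> = sets M" by (simp add: \<nu>_def)
  \<comment> \<open>In \<open>ennreal\<close> conjugacy gives \<open>1 / p \<le> 1\<close>; the
    value \<open>p = 0\<close> is excluded because \<open>1 / 0\<close> is infinite there.\<close>
  have p: "1 \<le> p"
  proof -
    have "1 / p \<le> 1" using assms(8) by (metis le_iff_add)
    then show ?thesis
    proof (cases p)
      case (real u)
      with \<open>1 / p \<le> 1\<close> have "u \<noteq> 0" by (auto simp: divide_ennreal_def top_unique)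
      with real \<open>1 / p \<le> 1\<close> have "ennreal (inverse u) \<le> ennreal 1"
        by (simp add: divide_ennreal_def inverse_ennreal)
      then have "inverse u \<le> 1" by (subst (asm) ennreal_le_iff) auto
      with real \<open>u \<noteq> 0\<close> show ?thesis by (simp add: inverse_le_1_iff)
    qed simp
  qed
  have approx: "\<exists>s\<in>B. (LINT x|M. \<bar>r x - s x\<bar>) < e" if "0 < e" for e
    by (rule Lp_closure_L1_approx[OF p assms(9) that]) (auto simp: real_norm_def)
  have diff: "(\<lambda>n. (LINT x|\<nu>. F (Z n x)) - (LINT x|M. F (Z n x))) \<longlonglongrightarrow> 0"
    if F: "L-lipschitz_on UNIV F" "bounded (range F)" for F :: "(real ^ 'd) cadlag \<Rightarrow> real" and L
  proof -
    obtain C where C: "\<And>w. \<bar>F w\<bar> \<le> C" using F(2) by (auto simp: bounded_iff)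
    have mF: "F \<in> borel_measurable borel"
      by (rule borel_measurable_continuous_onI[OF lipschitz_on_continuous_on[OF F(1)]])
    have "(LINT x|\<nu>. F (Z n x)) = (LINT x|M. r x * F (Z n x))" for n
      unfolding \<nu>_def Z_def
      by (subst integral_real_density[OF assms(5) r0])
        (auto intro: measurable_compose[OF partial_sum_process_measurable[OF assms(2,4)] mF])
    then show ?thesis
      using asymptotic_independence[OF assms(1-4) r assms(7) approx assms(12) F(1) C]
      by (simp add: Z_def)
  qed
  have diff': "(\<lambda>n. (LINT x|M. F (Z n x)) - (LINT x|\<nu>. F (Z n x))) \<longlonglongrightarrow> 0"
    if F: "L-lipschitz_on UNIV F" "bounded (range F)" for F :: "(real ^ 'd) cadlag \<Rightarrow> real" and L
    using tendsto_minus[OF diff[OF F]] by simp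
  have "converges_in_distribution M Z Q \<Longrightarrow> converges_in_distribution \<nu> Z Q" for Q
    by (rule converges_in_distribution_transfer[OF assms(1) \<nu> sets _ diff])
  moreover have "converges_in_distribution \<nu> Z Q \<Longrightarrow> converges_in_distribution M Z Q" for Q
    by (rule converges_in_distribution_transfer[OF \<nu> assms(1) sets[symmetric] _ diff'])
  ultimately show ?thesis unfolding Let_def \<nu>_def Z_def by blast
qed

end
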